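(* Let the assumption on the large-scale parameters stated in the context hold, so that $\mu>0$ is constant and the continuum parameters are separable, with $\lambda$ constant in $x$: $$\lambda(x,y)=\lambda_y(y),\quad W(x,y)=W_x(x)W_y(y),\quad \sigma(x,y,\eta)=\sigma_x(x)\sigma_y(y)\sigma_\eta(\eta),\quad \theta(x,y)=\theta_x(x)\theta_y(y),$$ satisfying $\lambda_y(i/n)=\lambda_i$, $W_y(i/n)=w_i$, $\theta_y(i/n)=\vartheta_i$, $\sigma_y(i/n)=s_{1,i}$, $\sigma_\eta(i/n)=s_{2,i}$ for all $i=1,\dots,n$. Write $\lambda(y)$ for $\lambda_y(y)$. Additionally assume that there exists a constant $c_x$ satisfying $$c_x=\mu\sigma_x(0)\frac{\sigma_\eta(y)}{\theta_y(y)}\int_0^1\frac{\sigma_y(\eta)\theta_y(\eta)}{\lambda(\eta)+\mu}\,d\eta+\frac{\mu\lambda(y)}{\lambda(y)+\mu}\frac{\theta_x'(0)}{\theta_x(0)}+\theta_x(0)\int_0^1\lambda(\eta)q(\eta)\frac{\theta_y(\eta)}{\lambda(\eta)+\mu}\,d\eta,$$ independently of $y$, and a related function $f$ satisfying $$f(\xi)=\sigma_x(\xi)\frac{\sigma_\eta(y)}{\theta_y(y)}\int_0^1\frac{\sigma_y(\eta)\theta_y(\eta)}{\lambda(\eta)+\mu}\,d\eta-\frac{c_x}{\mu}+\frac{\lambda(y)}{\lambda(y)+\mu}\frac{\theta_x'(\xi)}{\theta_x(\xi)},$$ for all $\xi\in[0,1]$, independently of $y$, and $$f'(\xi)=W_x(\xi)\theta_x(\xi)\int_0^1\frac{W_y(y)\theta_y(y)}{\lambda(y)+\mu}\,dy,$$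 for all $\xi\in[0,1]$. Then the solution $(k,\bar k)$ to the continuum kernel equations (K1), (K2), (B1), (B2) given in the context is $$k(x,\xi,y)=-\exp\left(\frac{c_x}{\mu}x\right)\exp\left(-\frac{c_x}{\mu}\xi\right)\theta_x(\xi)\frac{\theta_y(y)}{\lambda(y)+\mu},$$ $$\bar k(x,\xi)=\exp\left(\frac{c_x}{\mu}x\right)f(\xi)\exp\left(-\frac{c_x}{\mu}\xi\right).$$
   Context: Let $\mathcal{T}=\{(x,\xi)\in[0,1]^2:0\le\xi\le x\le1\}$ and $\mathcal{P}=\{(x,\xi,y)\in[0,1]^3:(x,\xi)\in\mathcal{T}\}$. The continuum kernel equations, with given parameters $\mu>0$, $\lambda>0$, $\sigma$, $\theta$, $W$, $q$ and unknowns $k$ on $\mathcal{P}$ and $\bar k$ on $\mathcal{T}$, are (K1) $\mu(x)\partial_xk(x,\xi,y)-\lambda(\xi,y)\partial_\xi k(x,\xi,y)-\theta(\xi,y)\bar k(x,\xi)=k(x,\xi,y)\,\partial_\xi\lambda(\xi,y)+\int_0^1\sigma(\xi,\eta,y)k(x,\xi,\eta)\,d\eta$, (K2) $\mu(x)\partial_x\bar k(x,\xi)+\mu(\xi)\partial_\xi\bar k(x,\xi)=-\mu'(\xi)\bar k(x,\xi)+\int_0^1W(\xi,y)k(x,\xi,y)\,dy$, with boundary conditions, for all $x\in[0,1]$ and almost every $y\in[0,1]$, (B1) $k(x,x,y)=-\dfrac{\theta(x,y)}{\lambda(x,y)+\mu(x)}$, (B2) $\mu(0)\bar k(x,0)=\int_0^1q(y)\lambda(0,y)k(x,0,y)\,dy$.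 The continuum parameters are assumed to be continuous in $y$ and $\eta$. In (K1), with $\sigma(x,y,\eta)=\sigma_x(x)\sigma_y(y)\sigma_\eta(\eta)$, one has $\sigma(\xi,\eta,y)=\sigma_x(\xi)\sigma_y(\eta)\sigma_\eta(y)$. These equations approximate the large-scale kernel equations, for $i=1,\dots,n$ and unknowns $k^1,\dots,k^{n+1}$ on $\mathcal{T}$, $\mu(x)\partial_xk^i(x,\xi)-\lambda_i(\xi)\partial_\xi k^i(x,\xi)=\lambda_i'(\xi)k^i(x,\xi)+\frac1n\sum_{j=1}^n\sigma_{j,i}(\xi)k^j(x,\xi)+\theta_i(\xi)k^{n+1}(x,\xi)$, $\mu(x)\partial_xk^{n+1}(x,\xi)+\mu(\xi)\partial_\xi k^{n+1}(x,\xi)=-\mu'(\xi)k^{n+1}(x,\xi)+\frac1n\sum_{j=1}^nW_j(\xi)k^j(x,\xi)$, with $k^i(x,x)=-\frac{\theta_i(x)}{\lambda_i(x)+\mu(x)}$ and $\mu(0)k^{n+1}(x,0)=\frac1n\sum_{j=1}^nq_j\lambda_j(0)k^j(x,0)$ for all $x\in[0,1]$. The continuum $q$ is related to the $q_i$ by $q(i/n)=q_i$, $i=1,\dots,n$. Assumption on the large-scale parameters: $\mu(x)=\mu$ and $\lambda_i(x)=\lambda_i$, where $\mu$ and $\lambda_i$, for all $i=1,\dots,n$, are positive constants; moreover $W_i(x)=w_iW_x(x)$, $\sigma_{i,j}(x)=s_{1,i}s_{2,j}\sigma_x(x)$ and $\theta_i(x)=\vartheta_i\theta_x(x)$ for some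 constants $w_i,s_{1,i},s_{2,j},\vartheta_i$, for all $i,j=1,\dots,n$. Under this assumption the continuum parameters can be constructed to be separable as in the claim.
   Formalization: The condition on f' is corrected to f'(ξ) = −(1/μ) W_x(ξ)θ_x(ξ)∫W_yθ_y/(λ+μ)dy, since the printed one contradicts (K2) unless f' = 0; that the pair is the only solution is claimed for σ_x and W_x bounded on [0,1]. *)

theory Defs
  imports "HOL-Analysis.Analysis"
begin

abbreviation unit_measure :: "real measure" where
  "unit_measure \<equiv> lebesgue_on {0..1}"

definition kernel_triangle :: "(real \<times> real) set" where
  "kernel_triangle = {(x, \<xi>). 0 \<le> \<xi> \<and> \<xi> \<le> x \<and> x \<le> 1}"

(* A representative of an element of C(S; L^2([0,1])). *)
definition L2_continuous_on ::
  "(real \<times> real) set \<Rightarrow> (real \<times> real \<Rightarrow> real \<Rightarrow> real) \<Rightarrow> bool" where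
  "L2_continuous_on S g \<longleftrightarrow>
     (\<forall>p\<in>S. g p \<in> borel_measurable unit_measure \<and>
        integrable unit_measure (\<lambda>y. (g p y)\<^sup>2) \<and>
        ((\<lambda>p'. LINT y|unit_measure. (g p' y - g p y)\<^sup>2) \<longlongrightarrow> 0) (at p within S))"

(* Derivatives are one-sided at the boundary.  A Frechet derivative within the triangle is unique
   even at its three corners, so the partial derivatives kx, k\<xi> below are determined by k.
   In the source term sig is evaluated as sig(\<xi>, \<eta>, y): the integration variable is in the
   second argument. *)
definition kernel_pde_at ::
  "(real \<Rightarrow> real) \<Rightarrow> (real \<Rightarrow> real \<Rightarrow> real) \<Rightarrow> (real \<Rightarrow> real \<Rightarrow> real \<Rightarrow> real) \<Rightarrow>
   (real \<Rightarrow> real \<Rightarrow> real) \<Rightarrow> (real \<Rightarrow> real \<Rightarrow> real \<Rightarrow> real) \<Rightarrow> (real \<Rightarrow> real \<Rightarrow> real) \<Rightarrow>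
   real \<Rightarrow> real \<Rightarrow> real \<Rightarrow> bool" where
  "kernel_pde_at mu lambda sig theta k kbar x \<xi> y \<longleftrightarrow>
     (\<exists>kx k\<xi> l'.
        ((\<lambda>(a, b). k a b y) has_derivative (\<lambda>(a, b). kx * a + k\<xi> * b)) (at (x, \<xi>) within kernel_triangle) \<and>
        ((\<lambda>s. lambda s y) has_real_derivative l') (at \<xi> within {0..1}) \<and>
        mu x * kx - lambda \<xi> y * k\<xi> - theta \<xi> y * kbar x \<xi> =
          k x \<xi> y * l' + (LINT \<eta>|unit_measure. sig \<xi> \<eta> y * k x \<xi> \<eta>))"

definition kernel_bar_pde_at ::
  "(real \<Rightarrow> real) \<Rightarrow> (real \<Rightarrow> real \<Rightarrow> real) \<Rightarrow>
   (real \<Rightarrow> real \<Rightarrow> real \<Rightarrow> real) \<Rightarrow> (real \<Rightarrow> real \<Rightarrow> real) \<Rightarrow> real \<Rightarrow> real \<Rightarrow> bool" where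
  "kernel_bar_pde_at mu W k kbar x \<xi> \<longleftrightarrow>
     (\<exists>kx k\<xi> m'.
        ((\<lambda>(a, b). kbar a b) has_derivative (\<lambda>(a, b). kx * a + k\<xi> * b)) (at (x, \<xi>) within kernel_triangle) \<and>
        (mu has_real_derivative m') (at \<xi> within {0..1}) \<and>
        mu x * kx + mu \<xi> * k\<xi> =
          - m' * kbar x \<xi> + (LINT y|unit_measure. W \<xi> y * k x \<xi> y))"

(* Classical in (x, \<xi>), L^2 in y, equations for k holding for almost every y. *)
definition kernel_solution ::
  "(real \<Rightarrow> real) \<Rightarrow> (real \<Rightarrow> real \<Rightarrow> real) \<Rightarrow> (real \<Rightarrow> real \<Rightarrow> real) \<Rightarrow>
   (real \<Rightarrow> real \<Rightarrow> real \<Rightarrow> real) \<Rightarrow> (real \<Rightarrow> real \<Rightarrow> real) \<Rightarrow> (real \<Rightarrow> real) \<Rightarrow>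
   (real \<Rightarrow> real \<Rightarrow> real \<Rightarrow> real) \<Rightarrow> (real \<Rightarrow> real \<Rightarrow> real) \<Rightarrow> bool" where
  "kernel_solution mu lambda W sig theta q k kbar \<longleftrightarrow>
     L2_continuous_on kernel_triangle (\<lambda>(x, \<xi>). k x \<xi>) \<and>
     (AE y in unit_measure. \<forall>(x, \<xi>)\<in>kernel_triangle. kernel_pde_at mu lambda sig theta k kbar x \<xi> y) \<and>
     (\<forall>(x, \<xi>)\<in>kernel_triangle. kernel_bar_pde_at mu W k kbar x \<xi>) \<and>
     (AE y in unit_measure. \<forall>x\<in>{0..1}. k x x y = - theta x y / (lambda x y + mu x)) \<and>
     (\<forall>x\<in>{0..1}. mu 0 * kbar x 0 = (LINT y|unit_measure. q y * lambda 0 y * k x 0 y))"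

end

theory Submission
  imports Defs
begin

text \<open>Existence is a substitution.  For uniqueness, the difference of two solutions has zero data on
  the diagonal and solves a homogeneous transport system whose sources are bounded by the \<open>L\<^sup>1\<close> norm
  of the first unknown in \<open>y\<close> and by the absolute value of the second.  A Gronwall argument along the
  characteristics, with weight \<open>exp (L * x)\<close> for large \<open>L\<close>, forces it to vanish.\<close>

text \<open>With \<open>c = c_x / mu0\<close>, each explicit kernel is
  \<open>exp (c * (x - \<xi>))\<close> times a function of the remaining variables, and (B1) then
  fixes the first one. (K1), divided by \<open>theta_x \<xi> * theta_y y\<close>, becomes
  \<open>f_eq\<close>; (K2) becomes \<open>f_deriv\<close>; (B2) results from comparing
  \<open>c_x_eq\<close> with \<open>mu0\<close> times \<open>f_eq\<close> at
  \<open>\<xi> = 0\<close>. The obstacle to uniqueness is that the sources are nonlocal in y while k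
  is only square integrable in y, so no single y can be treated alone. Characteristics are followed
  for almost every y, the resulting bound does not depend on y, and integrating it over [0,1] gives
  back a bound on the L1 norm. The iteration also needs some finite bound on both unknowns, uniform
  over the triangle; the notion of solution contains none explicitly, and compactness extracts
  it.\<close>

section \<open>The triangle and integration over the unit interval\<close>

lemma mem_kernel_triangle: "(x, \<xi>) \<in> kernel_triangle \<longleftrightarrow> 0 \<le> \<xi> \<and> \<xi> \<le> x \<and> x \<le> 1"
  by (simp add: kernel_triangle_def)

lemma compact_kernel_triangle: "compact kernel_triangle"
proof -
  have "kernel_triangle = ({0..1} \<times> {0..1}) \<inter> {p. snd p \<le> fst p}"
    by (auto simp: kernel_triangle_def)
  moreover have "closed {p::real \<times> real. snd p \<le> fst p}"
    by (intro closed_Collect_le continuous_intros)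
  ultimately show ?thesis
    by (metis compact_Int_closed compact_Times compact_Icc)
qed

lemma continuous_unit_measurable:
  fixes g :: "real \<Rightarrow> real"
  shows "continuous_on {0..1} g \<Longrightarrow> g \<in> borel_measurable unit_measure"
  by (intro continuous_imp_measurable_on_sets_lebesgue) auto

lemma measure_unit [simp]: "measure unit_measure {0..1} = 1"
  by (simp add: measure_restrict_space)

lemma continuous_unit_integrable:
  fixes g :: "real \<Rightarrow> real"
  assumes "continuous_on {0..1} g"
  shows "integrable unit_measure g"
proof -
  obtain C where C: "\<forall>y\<in>{0..1}. \<bar>g y\<bar> \<le> C"
    using compact_imp_bounded[OF compact_continuous_image[OF assms compact_Icc]]
    by (auto simp: bounded_iff)
  show ?thesis
    by (rule Bochner_Integration.integrable_bound[of _ "\<lambda>_. C"])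
       (use C in \<open>auto intro!: continuous_unit_measurable[OF assms] AE_I2 intro: abs_ge_self[THEN order_trans[rotated]]\<close>)
qed

section \<open>Estimates along characteristics and the homogeneous system\<close>

text \<open>A Frechet derivative within \<open>S\<close>, unlike a pair of partial derivatives,
  restricts to every segment in \<open>S\<close>; the chain rule within sets asks for it on the
  image of the segment. The direction \<open>(p, r)\<close> is left free so as to serve both
  families of characteristics, \<open>(m, - l y)\<close> and \<open>(m, m)\<close>.\<close>

lemma has_derivative_along_line:
  fixes g :: "real \<Rightarrow> real \<Rightarrow> real"
  assumes "((\<lambda>(a, b). g a b) has_derivative (\<lambda>(a, b). gx * a + g\<xi> * b)) (at (x + p * t, \<xi> + r * t) within S)"
    and "\<And>t. t \<in> {0..s} \<Longrightarrow> (x + p * t, \<xi> + r * t) \<in> S"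
  shows "((\<lambda>t. g (x + p * t) (\<xi> + r * t)) has_real_derivative p * gx + r * g\<xi>) (at t within {0..s})"
proof -
  let ?\<gamma> = "\<lambda>t. (x + p * t, \<xi> + r * t)"
  have "(?\<gamma> has_derivative (\<lambda>h. (p * h, r * h))) (at t within {0..s})"
    by (auto intro!: derivative_eq_intros)
  moreover have "((\<lambda>(a, b). g a b) has_derivative (\<lambda>(a, b). gx * a + g\<xi> * b)) (at (?\<gamma> t) within ?\<gamma> ` {0..s})"
    by (rule has_derivative_subset[OF assms(1)]) (use assms(2) in auto)
  ultimately have "((\<lambda>t. (\<lambda>(a, b). g a b) (?\<gamma> t)) has_derivative
      (\<lambda>h. (\<lambda>(a, b). gx * a + g\<xi> * b) (p * h, r * h))) (at t within {0..s})"
    by (rule has_derivative_in_compose)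
  then have "((\<lambda>t. g (x + p * t) (\<xi> + r * t)) has_derivative (\<lambda>h. gx * (p * h) + g\<xi> * (r * h))) (at t within {0..s})"
    by simp
  then show ?thesis
    unfolding has_field_derivative_def
    by (rule has_derivative_eq_rhs) (simp add: fun_eq_iff algebra_simps)
qed

text \<open>\<open>A / b * exp (b * t)\<close> is a primitive of the bound, and the mean value
  inequality compares increments. It replaces integration, since of \<open>g'\<close> only existence
  and a pointwise bound are known. The degenerate interval \<open>s = 0\<close> is treated apart
  because the inequality wants a proper one.\<close>

lemma exponential_growth_bound:
  fixes g :: "real \<Rightarrow> real"
  assumes "0 \<le> s" "0 < b" "0 \<le> A"
    and deriv: "\<And>t. t \<in> {0..s} \<Longrightarrow> (g has_real_derivative g' t) (at t within {0..s})"
    and bound: "\<And>t. t \<in> {0..s} \<Longrightarrow> \<bar>g' t\<bar> \<le> A * exp (b * t)"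
  shows "\<bar>g s - g 0\<bar> \<le> A / b * exp (b * s)"
proof (cases "s = 0")
  case False
  have "norm (g s - g 0) \<le> A / b * exp (b * s) - A / b * exp (b * 0)"
  proof (rule differentiable_bound_general[where \<phi> = "\<lambda>t. A / b * exp (b * t)"])
    show "continuous_on {0..s} g"
      by (rule DERIV_continuous_on[OF deriv])
    fix t assume "0 < t" "t < s"
    then have "at t within {0..s} = at t"
      by (intro at_within_interior) auto
    with deriv[of t] \<open>0 < t\<close> \<open>t < s\<close> show "(g has_vector_derivative g' t) (at t)"
      by (simp add: has_real_derivative_iff_has_vector_derivative)
    show "((\<lambda>t. A / b * exp (b * t)) has_vector_derivative A * exp (b * t)) (at t)"
      unfolding has_real_derivative_iff_has_vector_derivative[symmetric]
      using \<open>0 < b\<close> by (auto intro!: derivative_eq_intros)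
    show "norm (g' t) \<le> A * exp (b * t)"
      using bound[of t] \<open>0 < t\<close> \<open>t < s\<close> by simp
  qed (use assms False in \<open>auto intro!: continuous_intros\<close>)
  also have "\<dots> \<le> A / b * exp (b * s)"
    using assms by simp
  finally show ?thesis by simp
qed (use assms in auto)

text \<open>The existential hypothesis has the form in which the kernel equations provide
  derivatives; a choice turns them into functions of \<open>t\<close>. In the applications
  \<open>A\<close> contains the weight at the starting point, and \<open>b = L * m\<close> is the
  rate at which \<open>exp (L * x)\<close> grows when \<open>x\<close> moves at speed
  \<open>m\<close>.\<close>

lemma characteristic_bound:
  fixes g :: "real \<Rightarrow> real \<Rightarrow> real"
  assumes "0 \<le> s" "0 < b" "0 \<le> A"
    and S: "\<And>t. t \<in> {0..s} \<Longrightarrow> (x + p * t, \<xi> + r * t) \<in> S"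
    and deriv: "\<And>t. t \<in> {0..s} \<Longrightarrow> \<exists>gx g\<xi>.
      ((\<lambda>(a, b). g a b) has_derivative (\<lambda>(a, b). gx * a + g\<xi> * b)) (at (x + p * t, \<xi> + r * t) within S)
      \<and> \<bar>p * gx + r * g\<xi>\<bar> \<le> A * exp (b * t)"
  shows "\<bar>g (x + p * s) (\<xi> + r * s)\<bar> \<le> \<bar>g x \<xi>\<bar> + A / b * exp (b * s)"
proof -
  obtain gx g\<xi> where D: "\<And>t. t \<in> {0..s} \<Longrightarrow>
      ((\<lambda>(a, b). g a b) has_derivative (\<lambda>(a, b). gx t * a + g\<xi> t * b)) (at (x + p * t, \<xi> + r * t) within S)"
      "\<And>t. t \<in> {0..s} \<Longrightarrow> \<bar>p * gx t + r * g\<xi> t\<bar> \<le> A * exp (b * t)"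
    using deriv by metis
  have "\<bar>g (x + p * s) (\<xi> + r * s) - g (x + p * 0) (\<xi> + r * 0)\<bar> \<le> A / b * exp (b * s)"
    by (rule exponential_growth_bound[OF assms(1-3) has_derivative_along_line[OF D(1) S] D(2)])
  then show ?thesis by simp
qed

text \<open>A bound \<open>N * exp (L * x)\<close> on both unknowns improves to half of itself: every characteristic
  runs in the direction of increasing \<open>x\<close>, so integrating the weight along it gains a factor
  proportional to \<open>1 / L\<close>, and the boundary value of \<open>Kb\<close> at \<open>\<xi> = 0\<close> is controlled by the already
  improved bound on \<open>K\<close>.  The bounds on the source terms are pointwise, so no measurability in \<open>\<xi>\<close>
  is required.\<close>
lemma homogeneous_kernel_zero:
  fixes K :: "real \<Rightarrow> real \<Rightarrow> real \<Rightarrow> real" and Kb :: "real \<Rightarrow> real \<Rightarrow> real" and l :: "real \<Rightarrow> real"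
  assumes m: "m > 0" and l: "\<And>y. y \<in> {0..1} \<Longrightarrow> l y > 0" and C: "C \<ge> 0"
    and int: "\<And>x \<xi>. (x, \<xi>) \<in> kernel_triangle \<Longrightarrow> integrable unit_measure (K x \<xi>)"
    and K_bd: "\<And>x \<xi>. (x, \<xi>) \<in> kernel_triangle \<Longrightarrow> (LINT y|unit_measure. \<bar>K x \<xi> y\<bar>) \<le> B"
    and Kb_bd: "\<And>x \<xi>. (x, \<xi>) \<in> kernel_triangle \<Longrightarrow> \<bar>Kb x \<xi>\<bar> \<le> B"
    and K_pde: "AE y in unit_measure. \<forall>(x, \<xi>)\<in>kernel_triangle. \<exists>kx k\<xi>.
        ((\<lambda>(a, b). K a b y) has_derivative (\<lambda>(a, b). kx * a + k\<xi> * b)) (at (x, \<xi>) within kernel_triangle) \<and>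
        \<bar>m * kx - l y * k\<xi>\<bar> \<le> C * (\<bar>Kb x \<xi>\<bar> + (LINT y|unit_measure. \<bar>K x \<xi> y\<bar>))"
    and Kb_pde: "\<And>x \<xi>. (x, \<xi>) \<in> kernel_triangle \<Longrightarrow> \<exists>kx k\<xi>.
        ((\<lambda>(a, b). Kb a b) has_derivative (\<lambda>(a, b). kx * a + k\<xi> * b)) (at (x, \<xi>) within kernel_triangle) \<and>
        \<bar>m * kx + m * k\<xi>\<bar> \<le> C * (LINT y|unit_measure. \<bar>K x \<xi> y\<bar>)"
    and K_diag: "AE y in unit_measure. \<forall>x\<in>{0..1}. K x x y = 0"
    and Kb_bdry: "\<And>x. x \<in> {0..1} \<Longrightarrow> \<bar>Kb x 0\<bar> \<le> C * (LINT y|unit_measure. \<bar>K x 0 y\<bar>)"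
  shows "(AE y in unit_measure. \<forall>(x, \<xi>)\<in>kernel_triangle. K x \<xi> y = 0) \<and>
    (\<forall>(x, \<xi>)\<in>kernel_triangle. Kb x \<xi> = 0)"
proof -
  \<comment> \<open>One sweep along characteristics improves \<open>N\<close> to
    \<open>2 * C * N / (L * m)\<close> for \<open>K\<close>, the 2 coming from the two terms of its
    source, and to \<open>(2 * C\<^sup>2 + C) * N / (L * m)\<close> for \<open>Kb\<close>, the
    square coming from the data at \<xi> = 0. The choice gives
    \<open>L * m / 2 = 2 * C\<^sup>2 + 2 * C + 2\<close>, which dominates both coefficients; the
    summand 1 keeps \<open>L\<close> positive when \<open>C = 0\<close>.\<close>
  define L where "L = 4 * (C\<^sup>2 + C + 1) / m"
  define nK where "nK x \<xi> = (LINT y|unit_measure. \<bar>K x \<xi> y\<bar>)" for x \<xi>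
  define bd where "bd N \<longleftrightarrow> (\<forall>(x, \<xi>)\<in>kernel_triangle.
    nK x \<xi> \<le> N * exp (L * x) \<and> \<bar>Kb x \<xi>\<bar> \<le> N * exp (L * x))" for N
  have C2: "0 \<le> C\<^sup>2" by simp
  have Lm: "L * m = 4 * (C\<^sup>2 + C + 1)" using m by (simp add: L_def)
  then have Lm_pos: "L * m > 0" using C by (simp add: add_nonneg_pos)
  then have "L > 0" using m by (simp add: zero_less_mult_iff)
  \<comment> \<open>The null set is chosen before the point \<open>(x, \<xi>)\<close>, so a whole
    characteristic can be followed for one fixed \<open>y\<close>. As \<open>x\<close> moves at
    speed \<open>m\<close> for every \<open>y\<close>, the bound is uniform in \<open>y\<close>
    although \<open>l y\<close> varies.\<close>
  have K_step: "AE y in unit_measure. \<forall>(x, \<xi>)\<in>kernel_triangle. \<bar>K x \<xi> y\<bar> \<le> 2 * C * N / (L * m) * exp (L * x)"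
    if N: "bd N" and "N \<ge> 0" for N
    using K_pde K_diag AE_space
  proof eventually_elim
    fix y assume pde: "\<forall>(x, \<xi>)\<in>kernel_triangle. \<exists>kx k\<xi>.
        ((\<lambda>(a, b). K a b y) has_derivative (\<lambda>(a, b). kx * a + k\<xi> * b)) (at (x, \<xi>) within kernel_triangle) \<and>
        \<bar>m * kx - l y * k\<xi>\<bar> \<le> C * (\<bar>Kb x \<xi>\<bar> + (LINT y|unit_measure. \<bar>K x \<xi> y\<bar>))"
      and diag: "\<forall>x\<in>{0..1}. K x x y = 0" and "y \<in> space unit_measure"
    then have ly: "l y > 0" using l by simp
    show "\<forall>(x, \<xi>)\<in>kernel_triangle. \<bar>K x \<xi> y\<bar> \<le> 2 * C * N / (L * m) * exp (L * x)"
    proof clarify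
      fix x \<xi> assume tri: "(x, \<xi>) \<in> kernel_triangle"
      then have T: "0 \<le> \<xi>" "\<xi> \<le> x" "x \<le> 1" by (simp_all add: mem_kernel_triangle)
      \<comment> \<open>Going backwards from \<open>(x, \<xi>)\<close>, the gap
        \<open>x - \<xi>\<close> closes at speed \<open>m + l y\<close>, so the diagonal is met at
        \<open>(d, d)\<close> after time \<open>s\<close>.\<close>
      define s where "s = (x - \<xi>) / (m + l y)"
      define d where "d = x - m * s"
      have s: "0 \<le> s" using T m ly by (simp add: s_def)
      have dx: "x = d + m * s" by (simp add: d_def)
      have "(m + l y) * s = x - \<xi>" using m ly by (simp add: s_def)
      then have d\<xi>: "\<xi> = d + (- l y) * s" by (simp add: d_def algebra_simps)
      have ls: "0 \<le> l y * s" "0 \<le> m * s" using ly m s by simp_all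
      have "0 \<le> d" using d\<xi> T ls by linarith
      moreover have "d \<le> 1" using dx T ls by linarith
      ultimately have d: "d \<in> {0..1}" by simp
      have path: "(d + m * t, d + (- l y) * t) \<in> kernel_triangle" if "t \<in> {0..s}" for t
      proof -
        have "0 \<le> l y * t" "0 \<le> m * t" "l y * t \<le> l y * s" "m * t \<le> m * s" using that ly m by auto
        then show ?thesis using T dx d\<xi> unfolding mem_kernel_triangle by linarith
      qed
      have "\<bar>K (d + m * s) (d + (- l y) * s) y\<bar> \<le> \<bar>K d d y\<bar> + (2 * C * N * exp (L * d)) / (L * m) * exp (L * m * s)"
      proof (rule characteristic_bound[where g = "\<lambda>a b. K a b y", OF s Lm_pos _ path])
        show "0 \<le> 2 * C * N * exp (L * d)" using C \<open>N \<ge> 0\<close> by simp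
      next
        fix t assume t: "t \<in> {0..s}"
        let ?X = "d + m * t" and ?Y = "d + (- l y) * t"
        have "\<bar>Kb ?X ?Y\<bar> + nK ?X ?Y \<le> 2 * N * exp (L * ?X)"
          using N path[OF t] by (fastforce simp: bd_def)
        then have "C * (\<bar>Kb ?X ?Y\<bar> + nK ?X ?Y) \<le> C * (2 * N * exp (L * ?X))"
          using C by (rule mult_left_mono)
        also have "\<dots> = 2 * C * N * exp (L * d) * exp (L * m * t)"
          by (simp add: distrib_left exp_add mult_ac)
        finally have *: "C * (\<bar>Kb ?X ?Y\<bar> + nK ?X ?Y) \<le> 2 * C * N * exp (L * d) * exp (L * m * t)" .
        obtain kx k\<xi> where "((\<lambda>(a, b). K a b y) has_derivative (\<lambda>(a, b). kx * a + k\<xi> * b)) (at (?X, ?Y) within kernel_triangle)"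
          "\<bar>m * kx - l y * k\<xi>\<bar> \<le> C * (\<bar>Kb ?X ?Y\<bar> + nK ?X ?Y)"
          using pde path[OF t] unfolding nK_def by fast
        with * show "\<exists>gx g\<xi>. ((\<lambda>(a, b). K a b y) has_derivative (\<lambda>(a, b). gx * a + g\<xi> * b)) (at (?X, ?Y) within kernel_triangle)
            \<and> \<bar>m * gx + (- l y) * g\<xi>\<bar> \<le> 2 * C * N * exp (L * d) * exp (L * m * t)"
          by fastforce
      qed
      also have "K d d y = 0" using diag d by blast
      also have "(2 * C * N * exp (L * d)) / (L * m) * exp (L * m * s) = 2 * C * N / (L * m) * exp (L * x)"
        by (simp add: dx distrib_left exp_add mult_ac)
      finally show "\<bar>K x \<xi> y\<bar> \<le> 2 * C * N / (L * m) * exp (L * x)"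
        using dx d\<xi> by simp
    qed
  qed
  have nK_step: "nK x \<xi> \<le> 2 * C * N / (L * m) * exp (L * x)"
    if "bd N" "N \<ge> 0" "(x, \<xi>) \<in> kernel_triangle" for N x \<xi>
  proof -
    \<comment> \<open>Total mass 1 turns a bound uniform in \<open>y\<close> into the same bound for
      the L1 norm.\<close>
    have "nK x \<xi> \<le> (LINT y|unit_measure. 2 * C * N / (L * m) * exp (L * x))"
      unfolding nK_def
    proof (rule integral_mono_AE)
      show "AE y in unit_measure. \<bar>K x \<xi> y\<bar> \<le> 2 * C * N / (L * m) * exp (L * x)"
        using K_step[OF that(1,2)] by eventually_elim (use that(3) in auto)
    qed (use int[OF that(3)] in auto)
    then show ?thesis by simp
  qed
  have step: "bd (N / 2)" if N: "bd N" "N \<ge> 0" for N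
    unfolding bd_def
  proof clarify
    fix x \<xi> assume tri: "(x, \<xi>) \<in> kernel_triangle"
    then have T: "0 \<le> \<xi>" "\<xi> \<le> x" "x \<le> 1" by (simp_all add: mem_kernel_triangle)
    \<comment> \<open>The characteristics of \<open>Kb\<close> have slope 1: the one through
      \<open>(x, \<xi>)\<close> starts at \<open>(x - \<xi>, 0)\<close>.\<close>
    define d where "d = x - \<xi>"
    define s where "s = \<xi> / m"
    have s: "0 \<le> s" and ms: "m * s = \<xi>" using T m by (simp_all add: s_def)
    have path: "(d + m * t, 0 + m * t) \<in> kernel_triangle" if "t \<in> {0..s}" for t
    proof -
      have "0 \<le> m * t" "m * t \<le> m * s" using that m by auto
      then show ?thesis using T ms unfolding mem_kernel_triangle d_def by linarith
    qed
    have "\<bar>Kb (d + m * s) (0 + m * s)\<bar> \<le> \<bar>Kb d 0\<bar> + (C * N * exp (L * d)) / (L * m) * exp (L * m * s)"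
    proof (rule characteristic_bound[OF s Lm_pos _ path])
      show "0 \<le> C * N * exp (L * d)" using C N by simp
    next
      fix t assume t: "t \<in> {0..s}"
      let ?X = "d + m * t" and ?Y = "0 + m * t"
      have "nK ?X ?Y \<le> N * exp (L * ?X)"
        using N path[OF t] by (fastforce simp: bd_def)
      then have "C * nK ?X ?Y \<le> C * (N * exp (L * ?X))"
        using C by (rule mult_left_mono)
      also have "\<dots> = C * N * exp (L * d) * exp (L * m * t)"
        by (simp add: distrib_left exp_add mult_ac)
      finally have *: "C * nK ?X ?Y \<le> C * N * exp (L * d) * exp (L * m * t)" .
      then show "\<exists>gx g\<xi>. ((\<lambda>(a, b). Kb a b) has_derivative (\<lambda>(a, b). gx * a + g\<xi> * b)) (at (?X, ?Y) within kernel_triangle)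
          \<and> \<bar>m * gx + m * g\<xi>\<bar> \<le> C * N * exp (L * d) * exp (L * m * t)"
        using Kb_pde[OF path[OF t]] unfolding nK_def by (meson order_trans)
    qed
    moreover have "(C * N * exp (L * d)) / (L * m) * exp (L * m * s) = C * N / (L * m) * exp (L * x)"
      using ms by (simp add: d_def right_diff_distrib exp_diff mult.assoc)
    \<comment> \<open>The assumed bound on \<open>nK\<close> would not do here: the boundary
      condition gains no factor \<open>1 / (L * m)\<close> of its own and has to inherit it from
      \<open>nK_step\<close>.\<close>
    moreover have "\<bar>Kb d 0\<bar> \<le> 2 * C\<^sup>2 * N / (L * m) * exp (L * x)"
    proof -
      have "(d, 0) \<in> kernel_triangle" "d \<in> {0..1}" using T by (auto simp: mem_kernel_triangle d_def)
      then have "\<bar>Kb d 0\<bar> \<le> C * nK d 0" "nK d 0 \<le> 2 * C * N / (L * m) * exp (L * d)"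
        using Kb_bdry nK_step[OF N] by (auto simp: nK_def)
      then have "\<bar>Kb d 0\<bar> \<le> C * (2 * C * N / (L * m) * exp (L * d))"
        using C by (meson mult_left_mono order_trans)
      also have "\<dots> \<le> C * (2 * C * N / (L * m) * exp (L * x))"
        using C N Lm_pos \<open>L > 0\<close> T by (intro mult_left_mono) (auto simp: d_def)
      finally show ?thesis by (simp add: power2_eq_square mult_ac)
    qed
    moreover have "d + m * s = x" "0 + m * s = \<xi>" using ms by (simp_all add: d_def)
    ultimately have "\<bar>Kb x \<xi>\<bar> \<le> 2 * C\<^sup>2 * N / (L * m) * exp (L * x) + C * N / (L * m) * exp (L * x)"
      by (simp only:)
    also have "\<dots> = (2 * C\<^sup>2 + C) * N / (L * m) * exp (L * x)"
      by (simp add: distrib_right add_divide_distrib)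
    also have "(2 * C\<^sup>2 + C) * N / (L * m) \<le> N / 2"
    proof -
      have "(2 * C\<^sup>2 + C) * N \<le> (L * m / 2) * N"
        unfolding Lm using C C2 N by (intro mult_right_mono) auto
      then show ?thesis using Lm_pos by (simp add: divide_le_eq mult_ac)
    qed
    finally have Kb: "\<bar>Kb x \<xi>\<bar> \<le> N / 2 * exp (L * x)" by simp
    have "nK x \<xi> \<le> 2 * C * N / (L * m) * exp (L * x)"
      using nK_step[OF N tri] .
    also have "2 * C * N / (L * m) \<le> N / 2"
    proof -
      have "2 * C * N \<le> (L * m / 2) * N"
        unfolding Lm using C C2 N by (intro mult_right_mono) auto
      then show ?thesis using Lm_pos by (simp add: divide_le_eq mult_ac)
    qed
    finally show "nK x \<xi> \<le> N / 2 * exp (L * x) \<and> \<bar>Kb x \<xi>\<bar> \<le> N / 2 * exp (L * x)"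
      using Kb by simp
  qed
  have "(0, 0) \<in> kernel_triangle" by (simp add: mem_kernel_triangle)
  from Kb_bd[OF this] have "B \<ge> 0" by linarith
  have "bd B"
    unfolding bd_def
  proof clarify
    fix x \<xi> assume tri: "(x, \<xi>) \<in> kernel_triangle"
    then have "B * 1 \<le> B * exp (L * x)"
      using \<open>B \<ge> 0\<close> \<open>L > 0\<close> by (intro mult_left_mono) (auto simp: mem_kernel_triangle)
    then show "nK x \<xi> \<le> B * exp (L * x) \<and> \<bar>Kb x \<xi>\<bar> \<le> B * exp (L * x)"
      using K_bd[OF tri] Kb_bd[OF tri] unfolding nK_def by linarith
  qed
  have bd_pow: "bd (B * (1 / 2) ^ j)" for j
  proof (induction j)
    case (Suc j)
    then show ?case using step[OF Suc] \<open>B \<ge> 0\<close> by simp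
  qed (simp add: \<open>bd B\<close>)
  have "bd 0"
    unfolding bd_def
  proof clarify
    fix x \<xi> assume tri: "(x, \<xi>) \<in> kernel_triangle"
    have "(\<lambda>j. B * (1 / 2) ^ j * exp (L * x)) \<longlonglongrightarrow> B * 0 * exp (L * x)"
      by (intro tendsto_intros LIMSEQ_power_zero) auto
    from LIMSEQ_le_const[OF this] show "nK x \<xi> \<le> 0 * exp (L * x) \<and> \<bar>Kb x \<xi>\<bar> \<le> 0 * exp (L * x)"
      using bd_pow tri unfolding bd_def by fastforce
  qed
  \<comment> \<open>\<open>bd 0\<close> alone gives a null set for each point of the triangle. One
    more sweep with \<open>N = 0\<close> gives a null set common to all points.\<close>
  from K_step[OF this] have "AE y in unit_measure. \<forall>(x, \<xi>)\<in>kernel_triangle. K x \<xi> y = 0"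
    by simp
  with \<open>bd 0\<close> show ?thesis by (auto simp: bd_def)
qed


section \<open>A priori bounds and uniqueness for the kernel equations\<close>

text \<open>On a finite measure space \<open>|a| <= 1 + a^2\<close> puts L2 inside L1; the
  inequality is read off from \<open>(|a| - 1/2)^2 >= 0\<close>.\<close>

lemma L2_continuous_on_integrable:
  assumes "L2_continuous_on S g" "p \<in> S"
  shows "integrable unit_measure (g p)"
proof -
  have g: "g p \<in> borel_measurable unit_measure" "integrable unit_measure (\<lambda>y. (g p y)\<^sup>2)"
    using assms by (auto simp: L2_continuous_on_def)
  have "\<bar>a\<bar> \<le> 1 + a\<^sup>2" for a :: real
    using zero_le_power2[of "\<bar>a\<bar> - 1 / 2"] by (simp only: power2_diff power2_abs) (simp add: power2_eq_square)
  then have ae: "AE y in unit_measure. norm (g p y) \<le> norm (1 + (g p y)\<^sup>2)"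
    by (intro AE_I2) simp
  have "integrable unit_measure (\<lambda>y. 1 + (g p y)\<^sup>2)"
    using g(2) by simp
  then show ?thesis
    by (rule Bochner_Integration.integrable_bound[OF _ g(1) ae])
qed

text \<open>Near each point the squared L2 distance is below 1, and
  \<open>|a| <= |b| + 1 + (a - b)^2\<close> turns this into a local bound on the L1 norm. By
  compactness finitely many local bounds suffice.\<close>

lemma L2_continuous_on_integral_bounded:
  assumes g: "L2_continuous_on S g" and "compact S"
  obtains B where "\<And>p. p \<in> S \<Longrightarrow> (LINT y|unit_measure. \<bar>g p y\<bar>) \<le> B"
proof -
  let ?N = "\<lambda>p. LINT y|unit_measure. \<bar>g p y\<bar>"
  have "\<exists>U. open U \<and> p \<in> U \<and> (\<forall>p'\<in>U \<inter> S. ?N p' \<le> ?N p + 2)" if p: "p \<in> S" for p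
  proof -
    let ?D = "\<lambda>p'. LINT y|unit_measure. (g p' y - g p y)\<^sup>2"
    have "(?D \<longlongrightarrow> 0) (at p within S)"
      using g p by (auto simp: L2_continuous_on_def)
    then have "eventually (\<lambda>p'. ?D p' < 1) (at p within S)"
      by (rule order_tendstoD) simp
    then obtain U where U: "open U" "p \<in> U" "\<And>p'. p' \<in> U \<Longrightarrow> p' \<noteq> p \<Longrightarrow> p' \<in> S \<Longrightarrow> ?D p' < 1"
      unfolding eventually_at_topological by auto
    have "?N p' \<le> ?N p + 2" if p': "p' \<in> U \<inter> S" for p'
    proof -
      have sq: "g r \<in> borel_measurable unit_measure" "integrable unit_measure (\<lambda>y. (g r y)\<^sup>2)" if "r \<in> S" for r
        using g that by (auto simp: L2_continuous_on_def)
      have "(a - b)\<^sup>2 \<le> 2 * a\<^sup>2 + 2 * b\<^sup>2" for a b :: real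
        using zero_le_power2[of "a + b"] by (simp add: power2_sum power2_diff)
      then have ae: "AE y in unit_measure. norm ((g p' y - g p y)\<^sup>2) \<le> norm (2 * (g p' y)\<^sup>2 + 2 * (g p y)\<^sup>2)"
        by (intro AE_I2) simp
      \<comment> \<open>A nonintegrable function has Bochner integral 0, so the smallness of
        \<open>?D p'\<close> is informative only once integrability is known.\<close>
      have D: "integrable unit_measure (\<lambda>y. (g p' y - g p y)\<^sup>2)"
      proof (rule Bochner_Integration.integrable_bound[OF _ _ ae])
        show "integrable unit_measure (\<lambda>y. 2 * (g p' y)\<^sup>2 + 2 * (g p y)\<^sup>2)"
          using sq(2)[of p] sq(2)[of p'] p p' by simp
        have [measurable]: "g p \<in> borel_measurable unit_measure" "g p' \<in> borel_measurable unit_measure"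
          using sq(1) p p' by auto
        show "(\<lambda>y. (g p' y - g p y)\<^sup>2) \<in> borel_measurable unit_measure"
          by measurable
      qed
      have "\<bar>a\<bar> \<le> \<bar>b\<bar> + (1 + (a - b)\<^sup>2)" for a b :: real
        proof -
        have "\<bar>a - b\<bar> \<le> 1 + (a - b)\<^sup>2"
          using zero_le_power2[of "\<bar>a - b\<bar> - 1 / 2"] by (simp only: power2_diff power2_abs) (simp add: power2_eq_square)
        then show ?thesis by linarith
      qed
      then have "?N p' \<le> (LINT y|unit_measure. \<bar>g p y\<bar> + (1 + (g p' y - g p y)\<^sup>2))"
        using p p' D L2_continuous_on_integrable[OF g] by (intro integral_mono) auto
      also have "\<dots> = ?N p + (1 + ?D p')"
        using p D L2_continuous_on_integrable[OF g] by simp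
      \<comment> \<open>The limit within \<open>S\<close> says nothing about \<open>p' = p\<close>,
        where \<open>?D\<close> is 0.\<close>
      also have "?D p' \<le> 1"
        using U(3)[of p'] p' by (cases "p' = p") auto
      finally show ?thesis by simp
    qed
    with U(1,2) show ?thesis by blast
  qed
  then obtain U where U: "\<And>p. p \<in> S \<Longrightarrow> open (U p) \<and> p \<in> U p \<and> (\<forall>p'\<in>U p \<inter> S. ?N p' \<le> ?N p + 2)"
    by metis
  obtain F where F: "F \<subseteq> S" "finite F" "S \<subseteq> \<Union>(U ` F)"
    by (rule compactE_image[OF \<open>compact S\<close>, of S U]) (use U in auto)
  \<comment> \<open>All summands are nonnegative, so the sum bounds each of them; unlike a maximum
    it also makes sense for empty \<open>F\<close>.\<close>
  have "?N p \<le> (\<Sum>r\<in>F. ?N r + 2)" if p: "p \<in> S" for p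
  proof -
    obtain r where r: "r \<in> F" "p \<in> U r" using F(3) p by blast
    then have "?N p \<le> ?N r + 2" using U[of r] F(1) p by blast
    also have "\<dots> \<le> (\<Sum>r\<in>F. ?N r + 2)"
      using r(1) F(2) by (intro member_le_sum add_nonneg_nonneg integral_nonneg_AE) simp_all
    finally show ?thesis .
  qed
  then show thesis by (rule that)
qed

text \<open>The integrals against \<open>sig\<close>, \<open>W\<close> and \<open>q * lambda\<close>
  all pair k with a bounded coefficient, so between two solutions they vary by at most a multiple of
  the L1 distance.\<close>

lemma weighted_integral_diff_bound:
  fixes a g h :: "real \<Rightarrow> real"
  assumes a: "a \<in> borel_measurable unit_measure" "\<And>y. y \<in> {0..1} \<Longrightarrow> \<bar>a y\<bar> \<le> C"
    and g: "integrable unit_measure g" and h: "integrable unit_measure h"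
  shows "\<bar>(LINT y|unit_measure. a y * g y) - (LINT y|unit_measure. a y * h y)\<bar>
    \<le> C * (LINT y|unit_measure. \<bar>g y - h y\<bar>)"
proof -
  have int: "integrable unit_measure (\<lambda>y. a y * u y)" if "integrable unit_measure u" for u
  proof (rule Bochner_Integration.integrable_bound[of _ "\<lambda>y. C * u y"])
    have "\<bar>a y\<bar> * \<bar>u y\<bar> \<le> \<bar>C\<bar> * \<bar>u y\<bar>" if "y \<in> {0..1}" for y
      using a(2)[OF that] by (intro mult_right_mono) auto
    then show "AE y in unit_measure. norm (a y * u y) \<le> norm (C * u y)"
      by (intro AE_I2) (auto simp: abs_mult)
  qed (use that a(1) in auto)
  have "(LINT y|unit_measure. a y * g y) - (LINT y|unit_measure. a y * h y) =
      (LINT y|unit_measure. a y * (g y - h y))"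
    using int g h by (simp add: right_diff_distrib)
  also have "\<bar>\<dots>\<bar> \<le> (LINT y|unit_measure. C * \<bar>g y - h y\<bar>)"
    using int g h a(2)
    by (intro integral_abs_bound_integral) (auto simp: abs_mult intro!: mult_right_mono)
  finally show ?thesis by simp
qed

text \<open>One-sided derivatives on a proper interval are unique, even at its ends. This forces the
  existentially quantified \<open>l'\<close> and \<open>m'\<close> of the kernel equations to vanish
  when \<open>lambda\<close> and \<open>mu\<close> are constant in space.\<close>

lemma derivative_zero_of_const_on_unit:
  fixes g :: "real \<Rightarrow> real"
  assumes "(g has_real_derivative d) (at \<xi> within {0..1})" "\<And>s. s \<in> {0..1} \<Longrightarrow> g s = c" "\<xi> \<in> {0..1}"
  shows "d = 0"
proof -
  have "((\<lambda>_. c) has_real_derivative d) (at \<xi> within {0..1})"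
    by (rule has_field_derivative_transform_within[OF assms(1) zero_less_one assms(3)]) (use assms in auto)
  moreover have "((\<lambda>_. c) has_real_derivative 0) (at \<xi> within {0..1})"
    by simp
  ultimately show ?thesis
    unfolding has_real_derivative_iff_has_vector_derivative
    using assms(3) vector_derivative_unique_within_closed_interval[of 0 1 \<xi> "\<lambda>_. c" d 0] by simp
qed

lemma has_derivative_diff_pair:
  fixes g h :: "real \<Rightarrow> real \<Rightarrow> real"
  assumes "((\<lambda>(a, b). g a b) has_derivative (\<lambda>(a, b). gx * a + g\<xi> * b)) F"
    and "((\<lambda>(a, b). h a b) has_derivative (\<lambda>(a, b). hx * a + h\<xi> * b)) F"
  shows "((\<lambda>(a, b). g a b - h a b) has_derivative (\<lambda>(a, b). (gx - hx) * a + (g\<xi> - h\<xi>) * b)) F"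
  using has_derivative_diff[OF assms]
  by (simp add: case_prod_unfold algebra_simps)

text \<open>Continuity of \<open>kbar\<close> is not part of \<open>kernel_solution\<close>; it
  follows from the Frechet derivative that (K2) provides at every point of the compact
  triangle.\<close>

lemma kernel_bar_bounded:
  assumes "\<forall>(x, \<xi>)\<in>kernel_triangle. kernel_bar_pde_at mu W k kbar x \<xi>"
  obtains B where "\<And>x \<xi>. (x, \<xi>) \<in> kernel_triangle \<Longrightarrow> \<bar>kbar x \<xi>\<bar> \<le> B"
proof -
  have "continuous_on kernel_triangle (\<lambda>(x, \<xi>). kbar x \<xi>)"
    unfolding continuous_on_eq_continuous_within
  proof
    fix p assume "p \<in> kernel_triangle"
    then show "continuous (at p within kernel_triangle) (\<lambda>(x, \<xi>). kbar x \<xi>)"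
      using assms by (cases p) (auto simp: kernel_bar_pde_at_def dest!: bspec intro: has_derivative_continuous)
  qed
  from compact_imp_bounded[OF compact_continuous_image[OF this compact_kernel_triangle]]
  obtain B where "\<forall>p\<in>kernel_triangle. \<bar>case p of (x, \<xi>) \<Rightarrow> kbar x \<xi>\<bar> \<le> B"
    by (auto simp: bounded_iff)
  then show thesis using that by fast
qed

text \<open>By linearity the difference of two solutions falls under
  \<open>homogeneous_kernel_zero\<close>. The bound on \<open>q * lambda\<close> is
  \<open>m * C\<close> because (B2) gets divided by \<open>m\<close>.\<close>

lemma kernel_solution_unique:
  assumes m: "m > 0" and mu: "\<And>x. x \<in> {0..1} \<Longrightarrow> mu x = m"
    and lambda: "\<And>x y. x \<in> {0..1} \<Longrightarrow> y \<in> {0..1} \<Longrightarrow> lambda x y = l y"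
    and l: "\<And>y. y \<in> {0..1} \<Longrightarrow> l y > 0"
    and sig: "\<And>\<xi> y. \<xi> \<in> {0..1} \<Longrightarrow> y \<in> {0..1} \<Longrightarrow> (\<lambda>\<eta>. sig \<xi> \<eta> y) \<in> borel_measurable unit_measure"
      "\<And>\<xi> \<eta> y. \<xi> \<in> {0..1} \<Longrightarrow> \<eta> \<in> {0..1} \<Longrightarrow> y \<in> {0..1} \<Longrightarrow> \<bar>sig \<xi> \<eta> y\<bar> \<le> C"
    and W: "\<And>\<xi>. \<xi> \<in> {0..1} \<Longrightarrow> W \<xi> \<in> borel_measurable unit_measure"
      "\<And>\<xi> y. \<xi> \<in> {0..1} \<Longrightarrow> y \<in> {0..1} \<Longrightarrow> \<bar>W \<xi> y\<bar> \<le> C"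
    and theta: "\<And>\<xi> y. \<xi> \<in> {0..1} \<Longrightarrow> y \<in> {0..1} \<Longrightarrow> \<bar>theta \<xi> y\<bar> \<le> C"
    and q: "(\<lambda>y. q y * lambda 0 y) \<in> borel_measurable unit_measure"
      "\<And>y. y \<in> {0..1} \<Longrightarrow> \<bar>q y * lambda 0 y\<bar> \<le> m * C"
    and sol: "kernel_solution mu lambda W sig theta q k kbar" "kernel_solution mu lambda W sig theta q k' kbar'"
  shows "(AE y in unit_measure. \<forall>(x, \<xi>)\<in>kernel_triangle. k x \<xi> y = k' x \<xi> y) \<and>
    (\<forall>(x, \<xi>)\<in>kernel_triangle. kbar x \<xi> = kbar' x \<xi>)"
proof -
  have L2: "L2_continuous_on kernel_triangle (\<lambda>(x, \<xi>). k x \<xi>)" "L2_continuous_on kernel_triangle (\<lambda>(x, \<xi>). k' x \<xi>)"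
    using sol by (simp_all add: kernel_solution_def)
  have int: "integrable unit_measure (k x \<xi>)" "integrable unit_measure (k' x \<xi>)"
    if "(x, \<xi>) \<in> kernel_triangle" for x \<xi>
    using L2[THEN L2_continuous_on_integrable, OF that] by simp_all
  obtain B1 where B1: "\<And>p. p \<in> kernel_triangle \<Longrightarrow> (LINT y|unit_measure. \<bar>(case p of (x, \<xi>) \<Rightarrow> k x \<xi>) y\<bar>) \<le> B1"
    by (rule L2_continuous_on_integral_bounded[OF L2(1) compact_kernel_triangle]) blast
  obtain B2 where B2: "\<And>p. p \<in> kernel_triangle \<Longrightarrow> (LINT y|unit_measure. \<bar>(case p of (x, \<xi>) \<Rightarrow> k' x \<xi>) y\<bar>) \<le> B2"
    by (rule L2_continuous_on_integral_bounded[OF L2(2) compact_kernel_triangle]) blast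
  obtain B3 where B3: "\<And>x \<xi>. (x, \<xi>) \<in> kernel_triangle \<Longrightarrow> \<bar>kbar x \<xi>\<bar> \<le> B3"
    by (rule kernel_bar_bounded[of mu W k kbar]) (use sol in \<open>auto simp: kernel_solution_def\<close>)
  obtain B4 where B4: "\<And>x \<xi>. (x, \<xi>) \<in> kernel_triangle \<Longrightarrow> \<bar>kbar' x \<xi>\<bar> \<le> B4"
    by (rule kernel_bar_bounded[of mu W k' kbar']) (use sol in \<open>auto simp: kernel_solution_def\<close>)
  define B where "B = max (B1 + B2) (B3 + B4)"
  have "(AE y in unit_measure. \<forall>(x, \<xi>)\<in>kernel_triangle. k x \<xi> y - k' x \<xi> y = 0) \<and>
    (\<forall>(x, \<xi>)\<in>kernel_triangle. kbar x \<xi> - kbar' x \<xi> = 0)"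
  proof (rule homogeneous_kernel_zero[where m = m and l = l and C = C and B = B])
    show "C \<ge> 0" using theta[of 0 0] by simp
  next
    fix x \<xi> assume tri: "(x, \<xi>) \<in> kernel_triangle"
    have "(LINT y|unit_measure. \<bar>k x \<xi> y - k' x \<xi> y\<bar>) \<le> (LINT y|unit_measure. \<bar>k x \<xi> y\<bar> + \<bar>k' x \<xi> y\<bar>)"
      using int[OF tri] by (intro integral_mono) auto
    also have "\<dots> = (LINT y|unit_measure. \<bar>k x \<xi> y\<bar>) + (LINT y|unit_measure. \<bar>k' x \<xi> y\<bar>)"
      using int[OF tri] by simp
    also have "\<dots> \<le> B"
      using B1[OF tri] B2[OF tri] by (simp add: B_def)
    finally show "(LINT y|unit_measure. \<bar>k x \<xi> y - k' x \<xi> y\<bar>) \<le> B" .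
    show "\<bar>kbar x \<xi> - kbar' x \<xi>\<bar> \<le> B"
      using B3[OF tri] B4[OF tri] by (simp add: B_def)
    have \<xi>: "x \<in> {0..1}" "\<xi> \<in> {0..1}" using tri by (auto simp: mem_kernel_triangle)
    obtain kx k\<xi> m1 where 1:
        "((\<lambda>(a, b). kbar a b) has_derivative (\<lambda>(a, b). kx * a + k\<xi> * b)) (at (x, \<xi>) within kernel_triangle)"
        "(mu has_real_derivative m1) (at \<xi> within {0..1})"
        "mu x * kx + mu \<xi> * k\<xi> = - m1 * kbar x \<xi> + (LINT y|unit_measure. W \<xi> y * k x \<xi> y)"
      using sol(1) tri unfolding kernel_solution_def kernel_bar_pde_at_def by blast
    obtain kx' k\<xi>' m2 where 2:
        "((\<lambda>(a, b). kbar' a b) has_derivative (\<lambda>(a, b). kx' * a + k\<xi>' * b)) (at (x, \<xi>) within kernel_triangle)"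
        "(mu has_real_derivative m2) (at \<xi> within {0..1})"
        "mu x * kx' + mu \<xi> * k\<xi>' = - m2 * kbar' x \<xi> + (LINT y|unit_measure. W \<xi> y * k' x \<xi> y)"
      using sol(2) tri unfolding kernel_solution_def kernel_bar_pde_at_def by blast
    have "m1 = 0" "m2 = 0"
      using derivative_zero_of_const_on_unit[OF 1(2) mu \<xi>(2)] derivative_zero_of_const_on_unit[OF 2(2) mu \<xi>(2)] by auto
    then have "m * (kx - kx') + m * (k\<xi> - k\<xi>') =
        (LINT y|unit_measure. W \<xi> y * k x \<xi> y) - (LINT y|unit_measure. W \<xi> y * k' x \<xi> y)"
      using 1(3) 2(3) mu[OF \<xi>(1)] mu[OF \<xi>(2)] by (simp add: algebra_simps)
    with weighted_integral_diff_bound[OF W[OF \<xi>(2)] int[OF tri]]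
    have "\<bar>m * (kx - kx') + m * (k\<xi> - k\<xi>')\<bar> \<le> C * (LINT y|unit_measure. \<bar>k x \<xi> y - k' x \<xi> y\<bar>)"
      by simp
    with has_derivative_diff_pair[OF 1(1) 2(1)]
    show "\<exists>kx k\<xi>. ((\<lambda>(a, b). kbar a b - kbar' a b) has_derivative (\<lambda>(a, b). kx * a + k\<xi> * b)) (at (x, \<xi>) within kernel_triangle) \<and>
        \<bar>m * kx + m * k\<xi>\<bar> \<le> C * (LINT y|unit_measure. \<bar>k x \<xi> y - k' x \<xi> y\<bar>)"
      by blast
  next
    have "AE y in unit_measure. \<forall>(x, \<xi>)\<in>kernel_triangle. kernel_pde_at mu lambda sig theta k kbar x \<xi> y"
      "AE y in unit_measure. \<forall>(x, \<xi>)\<in>kernel_triangle. kernel_pde_at mu lambda sig theta k' kbar' x \<xi> y"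
      using sol by (simp_all add: kernel_solution_def)
    then show "AE y in unit_measure. \<forall>(x, \<xi>)\<in>kernel_triangle. \<exists>kx k\<xi>.
        ((\<lambda>(a, b). k a b y - k' a b y) has_derivative (\<lambda>(a, b). kx * a + k\<xi> * b)) (at (x, \<xi>) within kernel_triangle) \<and>
        \<bar>m * kx - l y * k\<xi>\<bar> \<le> C * (\<bar>kbar x \<xi> - kbar' x \<xi>\<bar> + (LINT y|unit_measure. \<bar>k x \<xi> y - k' x \<xi> y\<bar>))"
      using AE_space
    proof (eventually_elim, clarify)
      fix y x \<xi>
      assume pde: "\<forall>(x, \<xi>)\<in>kernel_triangle. kernel_pde_at mu lambda sig theta k kbar x \<xi> y"
          "\<forall>(x, \<xi>)\<in>kernel_triangle. kernel_pde_at mu lambda sig theta k' kbar' x \<xi> y"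
        and "y \<in> space unit_measure" and tri: "(x, \<xi>) \<in> kernel_triangle"
      have y: "y \<in> {0..1}" using \<open>y \<in> space unit_measure\<close> by simp
      have \<xi>: "x \<in> {0..1}" "\<xi> \<in> {0..1}" using tri by (auto simp: mem_kernel_triangle)
      obtain kx k\<xi> l1 where 1:
          "((\<lambda>(a, b). k a b y) has_derivative (\<lambda>(a, b). kx * a + k\<xi> * b)) (at (x, \<xi>) within kernel_triangle)"
          "((\<lambda>s. lambda s y) has_real_derivative l1) (at \<xi> within {0..1})"
          "mu x * kx - lambda \<xi> y * k\<xi> - theta \<xi> y * kbar x \<xi> =
            k x \<xi> y * l1 + (LINT \<eta>|unit_measure. sig \<xi> \<eta> y * k x \<xi> \<eta>)"
        using pde(1) tri unfolding kernel_pde_at_def by blast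
      obtain kx' k\<xi>' l2 where 2:
          "((\<lambda>(a, b). k' a b y) has_derivative (\<lambda>(a, b). kx' * a + k\<xi>' * b)) (at (x, \<xi>) within kernel_triangle)"
          "((\<lambda>s. lambda s y) has_real_derivative l2) (at \<xi> within {0..1})"
          "mu x * kx' - lambda \<xi> y * k\<xi>' - theta \<xi> y * kbar' x \<xi> =
            k' x \<xi> y * l2 + (LINT \<eta>|unit_measure. sig \<xi> \<eta> y * k' x \<xi> \<eta>)"
        using pde(2) tri unfolding kernel_pde_at_def by blast
      have "l1 = 0" "l2 = 0"
        using derivative_zero_of_const_on_unit[OF 1(2) lambda[OF _ y] \<xi>(2)]
          derivative_zero_of_const_on_unit[OF 2(2) lambda[OF _ y] \<xi>(2)] by auto
      then have "m * (kx - kx') - l y * (k\<xi> - k\<xi>') = theta \<xi> y * (kbar x \<xi> - kbar' x \<xi>) +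
          ((LINT \<eta>|unit_measure. sig \<xi> \<eta> y * k x \<xi> \<eta>) - (LINT \<eta>|unit_measure. sig \<xi> \<eta> y * k' x \<xi> \<eta>))"
        using 1(3) 2(3) mu[OF \<xi>(1)] lambda[OF \<xi>(2) y] by (simp add: algebra_simps)
      moreover have "\<bar>theta \<xi> y * (kbar x \<xi> - kbar' x \<xi>)\<bar> \<le> C * \<bar>kbar x \<xi> - kbar' x \<xi>\<bar>"
        unfolding abs_mult using theta[OF \<xi>(2) y] by (intro mult_right_mono) auto
      moreover have "\<bar>(LINT \<eta>|unit_measure. sig \<xi> \<eta> y * k x \<xi> \<eta>) - (LINT \<eta>|unit_measure. sig \<xi> \<eta> y * k' x \<xi> \<eta>)\<bar>
          \<le> C * (LINT y|unit_measure. \<bar>k x \<xi> y - k' x \<xi> y\<bar>)"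
        by (rule weighted_integral_diff_bound[OF sig(1)[OF \<xi>(2) y] sig(2)[OF \<xi>(2) _ y] int[OF tri]])
      ultimately have "\<bar>m * (kx - kx') - l y * (k\<xi> - k\<xi>')\<bar>
          \<le> C * (\<bar>kbar x \<xi> - kbar' x \<xi>\<bar> + (LINT y|unit_measure. \<bar>k x \<xi> y - k' x \<xi> y\<bar>))"
        unfolding distrib_left by linarith
      with has_derivative_diff_pair[OF 1(1) 2(1)]
      show "\<exists>kx k\<xi>. ((\<lambda>(a, b). k a b y - k' a b y) has_derivative (\<lambda>(a, b). kx * a + k\<xi> * b)) (at (x, \<xi>) within kernel_triangle) \<and>
        \<bar>m * kx - l y * k\<xi>\<bar> \<le> C * (\<bar>kbar x \<xi> - kbar' x \<xi>\<bar> + (LINT y|unit_measure. \<bar>k x \<xi> y - k' x \<xi> y\<bar>))"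
        by blast
    qed
  next
    have "AE y in unit_measure. \<forall>x\<in>{0..1}. k x x y = - theta x y / (lambda x y + mu x)"
      "AE y in unit_measure. \<forall>x\<in>{0..1}. k' x x y = - theta x y / (lambda x y + mu x)"
      using sol by (simp_all add: kernel_solution_def)
    then show "AE y in unit_measure. \<forall>x\<in>{0..1}. k x x y - k' x x y = 0"
      by eventually_elim auto
  next
    fix x :: real assume x: "x \<in> {0..1}"
    then have tri: "(x, 0) \<in> kernel_triangle" by (simp add: mem_kernel_triangle)
    have "mu 0 * kbar x 0 - mu 0 * kbar' x 0 =
        (LINT y|unit_measure. q y * lambda 0 y * k x 0 y) - (LINT y|unit_measure. q y * lambda 0 y * k' x 0 y)"
      using sol x by (simp add: kernel_solution_def)
    then have "m * (kbar x 0 - kbar' x 0) =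
        (LINT y|unit_measure. q y * lambda 0 y * k x 0 y) - (LINT y|unit_measure. q y * lambda 0 y * k' x 0 y)"
      using mu[of 0] by (simp add: right_diff_distrib)
    then have "\<bar>m * (kbar x 0 - kbar' x 0)\<bar> \<le> (m * C) * (LINT y|unit_measure. \<bar>k x 0 y - k' x 0 y\<bar>)"
      using weighted_integral_diff_bound[OF q int[OF tri]] by presburger
    then show "\<bar>kbar x 0 - kbar' x 0\<bar> \<le> C * (LINT y|unit_measure. \<bar>k x 0 y - k' x 0 y\<bar>)"
      using m by (simp add: abs_mult mult.assoc)
  qed (use m l int in auto)
  then show ?thesis by simp
qed

section \<open>Substitution of the explicit kernels\<close>

text \<open>For fixed \<open>y\<close> both explicit kernels have the form
  \<open>exp (c * x) * g \<xi>\<close>, so one computation serves (K1) and (K2). The derivative of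
  \<open>g\<close> lifts through \<open>snd\<close>, which maps the triangle into [0,1].\<close>

lemma has_derivative_exp_times:
  assumes g: "(g has_real_derivative g') (at \<xi> within {0..1})"
  shows "((\<lambda>(a, b). exp (c * a) * g b) has_derivative
      (\<lambda>(a, b). (c * exp (c * x) * g \<xi>) * a + (exp (c * x) * g') * b)) (at (x, \<xi>) within kernel_triangle)"
proof -
  have "(g has_derivative (*) g') (at (snd (x, \<xi>)) within snd ` kernel_triangle)"
    using g unfolding has_field_derivative_def
    by (auto intro: has_derivative_subset simp: kernel_triangle_def)
  from has_derivative_in_compose[OF has_derivative_snd[OF has_derivative_ident] this]
  have [derivative_intros]: "((\<lambda>p. g (snd p)) has_derivative (\<lambda>h. g' * snd h)) (at (x, \<xi>) within kernel_triangle)" .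
  show ?thesis
    unfolding case_prod_unfold
    by (auto intro!: derivative_eq_intros simp: fun_eq_iff algebra_simps)
qed

text \<open>The squared L2 distance factors into \<open>(g p' - g p)\<^sup>2\<close> and a constant,
  the integral of \<open>h\<^sup>2\<close>.\<close>

lemma L2_continuous_on_separable:
  assumes g: "continuous_on S g" and h: "continuous_on {0..1} h"
  shows "L2_continuous_on S (\<lambda>p y. g p * h y)"
  unfolding L2_continuous_on_def
proof (intro ballI conjI)
  fix p assume p: "p \<in> S"
  show "(\<lambda>y. g p * h y) \<in> borel_measurable unit_measure"
    using continuous_unit_measurable[OF h] by simp
  show "integrable unit_measure (\<lambda>y. (g p * h y)\<^sup>2)"
    by (intro continuous_unit_integrable continuous_intros h)
  have "(g \<longlongrightarrow> g p) (at p within S)" using g p by (simp add: continuous_on_def)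
  then have "((\<lambda>p'. (g p' - g p)\<^sup>2 * (LINT y|unit_measure. (h y)\<^sup>2)) \<longlongrightarrow> (g p - g p)\<^sup>2 * (LINT y|unit_measure. (h y)\<^sup>2)) (at p within S)"
    by (intro tendsto_intros)
  then show "((\<lambda>p'. LINT y|unit_measure. (g p' * h y - g p * h y)\<^sup>2) \<longlongrightarrow> 0) (at p within S)"
    by (simp add: left_diff_distrib[symmetric] power_mult_distrib)
qed

text \<open>If the property failed everywhere, 1 = 0 would hold almost everywhere, against the
  integral of 1 being 1. This yields a point with \<open>theta_y y \<noteq> 0\<close> at which the
  conditions on \<open>c_x\<close> and \<open>f\<close> can be read.\<close>

lemma unit_measure_AE_witness:
  assumes "AE y in unit_measure. P y"
  obtains y where "y \<in> {0..1}" "P y"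
proof -
  have "\<exists>y\<in>{0..1}. P y"
  proof (rule ccontr)
    assume "\<not> (\<exists>y\<in>{0..1}. P y)"
    with assms have "AE y in unit_measure. (1::real) = 0"
      using AE_cong[of unit_measure P "\<lambda>_. (1::real) = 0"] by auto
    then have "(LINT y|unit_measure. (1::real)) = (LINT y|unit_measure. 0)"
      by (intro integral_cong_AE) auto
    then show False by simp
  qed
  then show thesis using that by blast
qed

text \<open>The factor \<open>- (1 / mu0)\<close> in \<open>f_deriv\<close>, absent from the English
  formula for f', is forced by (K2): the exponentials drop out and \<open>mu0 * f'\<close> must
  equal minus the product of \<open>W_x\<close>, \<open>theta_x\<close> and the integral.
  \<open>c_x_eq\<close> and \<open>f_eq\<close> are imposed only where \<open>theta_y\<close> is
  nonzero, since a quotient by 0 is 0 and would change their meaning; the excluded \<open>y\<close>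
  form a null set, which (K1) tolerates. Uniqueness is conditional on bounded \<open>sigma_x\<close>
  and \<open>W_x\<close> because the constant in the Gronwall argument dominates all
  coefficients.\<close>

theorem proposition2:
  fixes n :: nat
    and Lam Wi Theta_i :: "nat \<Rightarrow> real \<Rightarrow> real"
    and Sigma_ij :: "nat \<Rightarrow> nat \<Rightarrow> real \<Rightarrow> real"
    and lam w s1 s2 vtheta qi :: "nat \<Rightarrow> real"
    and mu q :: "real \<Rightarrow> real"
    and lambda W theta :: "real \<Rightarrow> real \<Rightarrow> real"
    and sig :: "real \<Rightarrow> real \<Rightarrow> real \<Rightarrow> real"
    and mu0 c_x :: real
    and lambda_y W_x W_y sigma_x sigma_y sigma_eta theta_x theta_x' theta_y f :: "real \<Rightarrow> real"
  assumes n: "n \<ge> 1"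
    and mu_const: "mu0 > 0" "\<And>x. x \<in> {0..1} \<Longrightarrow> mu x = mu0"
    and Lam_const: "\<And>i. i \<in> {1..n} \<Longrightarrow> lam i > 0"
      "\<And>i x. i \<in> {1..n} \<Longrightarrow> x \<in> {0..1} \<Longrightarrow> Lam i x = lam i"
    and Wi_sep: "\<And>i x. i \<in> {1..n} \<Longrightarrow> x \<in> {0..1} \<Longrightarrow> Wi i x = w i * W_x x"
    and Sigma_ij_sep: "\<And>i j x. i \<in> {1..n} \<Longrightarrow> j \<in> {1..n} \<Longrightarrow> x \<in> {0..1} \<Longrightarrow>
      Sigma_ij i j x = s1 i * s2 j * sigma_x x"
    and Theta_i_sep: "\<And>i x. i \<in> {1..n} \<Longrightarrow> x \<in> {0..1} \<Longrightarrow> Theta_i i x = vtheta i * theta_x x"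
    and lambda_sep: "\<And>x y. x \<in> {0..1} \<Longrightarrow> y \<in> {0..1} \<Longrightarrow> lambda x y = lambda_y y"
    and W_sep: "\<And>x y. x \<in> {0..1} \<Longrightarrow> y \<in> {0..1} \<Longrightarrow> W x y = W_x x * W_y y"
    and sigma_sep: "\<And>x y \<eta>. x \<in> {0..1} \<Longrightarrow> y \<in> {0..1} \<Longrightarrow> \<eta> \<in> {0..1} \<Longrightarrow>
      sig x y \<eta> = sigma_x x * sigma_y y * sigma_eta \<eta>"
    and theta_sep: "\<And>x y. x \<in> {0..1} \<Longrightarrow> y \<in> {0..1} \<Longrightarrow> theta x y = theta_x x * theta_y y"
    and interp: "\<And>i. i \<in> {1..n} \<Longrightarrow> lambda_y (real i / real n) = lam i"
      "\<And>i. i \<in> {1..n} \<Longrightarrow> W_y (real i / real n) = w i"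
      "\<And>i. i \<in> {1..n} \<Longrightarrow> theta_y (real i / real n) = vtheta i"
      "\<And>i. i \<in> {1..n} \<Longrightarrow> sigma_y (real i / real n) = s1 i"
      "\<And>i. i \<in> {1..n} \<Longrightarrow> sigma_eta (real i / real n) = s2 i"
      "\<And>i. i \<in> {1..n} \<Longrightarrow> q (real i / real n) = qi i"
    and lambda_pos: "\<And>y. y \<in> {0..1} \<Longrightarrow> lambda_y y > 0"
    and cont: "continuous_on {0..1} lambda_y" "continuous_on {0..1} W_y" "continuous_on {0..1} sigma_y"
      "continuous_on {0..1} sigma_eta" "continuous_on {0..1} theta_y" "continuous_on {0..1} q"
    and thetax_nz: "\<And>\<xi>. \<xi> \<in> {0..1} \<Longrightarrow> theta_x \<xi> \<noteq> 0"
    and thetax_deriv: "\<And>\<xi>. \<xi> \<in> {0..1} \<Longrightarrow> (theta_x has_real_derivative theta_x' \<xi>) (at \<xi> within {0..1})"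
    and thetay_nz: "AE y in unit_measure. theta_y y \<noteq> 0"
    and c_x_eq: "\<And>y. y \<in> {0..1} \<Longrightarrow> theta_y y \<noteq> 0 \<Longrightarrow>
      c_x = mu0 * sigma_x 0 * (sigma_eta y / theta_y y) * (LINT \<eta>|unit_measure. sigma_y \<eta> * theta_y \<eta> / (lambda_y \<eta> + mu0))
         + mu0 * lambda_y y / (lambda_y y + mu0) * (theta_x' 0 / theta_x 0)
         + theta_x 0 * (LINT \<eta>|unit_measure. lambda_y \<eta> * q \<eta> * (theta_y \<eta> / (lambda_y \<eta> + mu0)))"
    and f_eq: "\<And>\<xi> y. \<xi> \<in> {0..1} \<Longrightarrow> y \<in> {0..1} \<Longrightarrow> theta_y y \<noteq> 0 \<Longrightarrow>
      f \<xi> = sigma_x \<xi> * (sigma_eta y / theta_y y) * (LINT \<eta>|unit_measure. sigma_y \<eta> * theta_y \<eta> / (lambda_y \<eta> + mu0))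
          - c_x / mu0 + lambda_y y / (lambda_y y + mu0) * (theta_x' \<xi> / theta_x \<xi>)"
    and f_deriv: "\<And>\<xi>. \<xi> \<in> {0..1} \<Longrightarrow>
      (f has_real_derivative
         - (1 / mu0) * (W_x \<xi> * theta_x \<xi> * (LINT y|unit_measure. W_y y * theta_y y / (lambda_y y + mu0))))
        (at \<xi> within {0..1})"
  shows "kernel_solution mu lambda W sig theta q
      (\<lambda>x \<xi> y. - exp (c_x / mu0 * x) * exp (- (c_x / mu0) * \<xi>) * theta_x \<xi> * (theta_y y / (lambda_y y + mu0)))
      (\<lambda>x \<xi>. exp (c_x / mu0 * x) * f \<xi> * exp (- (c_x / mu0) * \<xi>))
    \<and> (bounded (sigma_x ` {0..1}) \<longrightarrow> bounded (W_x ` {0..1}) \<longrightarrow>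
       (\<forall>k kbar. kernel_solution mu lambda W sig theta q k kbar \<longrightarrow>
          (AE y in unit_measure. \<forall>(x, \<xi>)\<in>kernel_triangle.
             k x \<xi> y = - exp (c_x / mu0 * x) * exp (- (c_x / mu0) * \<xi>) * theta_x \<xi> * (theta_y y / (lambda_y y + mu0))) \<and>
          (\<forall>(x, \<xi>)\<in>kernel_triangle. kbar x \<xi> = exp (c_x / mu0 * x) * f \<xi> * exp (- (c_x / mu0) * \<xi>))))"
proof -
  let ?I = "LINT \<eta>|unit_measure. sigma_y \<eta> * theta_y \<eta> / (lambda_y \<eta> + mu0)"
  let ?k = "\<lambda>x \<xi> y. - exp (c_x / mu0 * x) * exp (- (c_x / mu0) * \<xi>) * theta_x \<xi> * (theta_y y / (lambda_y y + mu0))"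
  let ?kbar = "\<lambda>x \<xi>. exp (c_x / mu0 * x) * f \<xi> * exp (- (c_x / mu0) * \<xi>)"
  define c where "c = c_x / mu0"
  \<comment> \<open>The profile in \<open>y\<close> that (B1) dictates on the diagonal.\<close>
  define h where "h y = theta_y y / (lambda_y y + mu0)" for y
  have denom: "lambda_y y + mu0 > 0" if "y \<in> {0..1}" for y
    using lambda_pos[OF that] mu_const(1) by simp
  have h_cont: "continuous_on {0..1} h"
    unfolding h_def using denom by (intro continuous_intros cont) fastforce
  have thetax_cont: "continuous_on {0..1} theta_x"
    by (rule DERIV_continuous_on[OF thetax_deriv])
  have k_eq: "?k x \<xi> = (\<lambda>y. (- exp (c * x) * exp (- c * \<xi>) * theta_x \<xi>) * h y)" for x \<xi>
    by (simp add: c_def h_def)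
  have exp_deriv: "((\<lambda>b. exp (- c * b)) has_real_derivative - c * exp (- c * \<xi>)) (at \<xi> within {0..1})" for \<xi>
    by (auto intro!: derivative_eq_intros)
  have tri: "x \<in> {0..1}" "\<xi> \<in> {0..1}" if "(x, \<xi>) \<in> kernel_triangle" for x \<xi>
    using that by (auto simp: mem_kernel_triangle)
  have sol: "kernel_solution mu lambda W sig theta q ?k ?kbar"
    unfolding kernel_solution_def
  proof (intro conjI)
    have "continuous_on kernel_triangle (\<lambda>p. theta_x (snd p))"
      by (rule continuous_on_compose2[OF thetax_cont])
         (auto intro!: continuous_intros simp: mem_kernel_triangle)
    then have "continuous_on kernel_triangle (\<lambda>p. - exp (c * fst p) * exp (- c * snd p) * theta_x (snd p))"
      by (intro continuous_intros)
    from L2_continuous_on_separable[OF this h_cont]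
    show "L2_continuous_on kernel_triangle (\<lambda>(x, \<xi>). ?k x \<xi>)"
      unfolding k_eq case_prod_unfold .
  next
    show "AE y in unit_measure. \<forall>(x, \<xi>)\<in>kernel_triangle. kernel_pde_at mu lambda sig theta ?k ?kbar x \<xi> y"
      using thetay_nz AE_space
    proof (eventually_elim, clarify)
      fix y x \<xi> assume nz: "theta_y y \<noteq> 0" and "y \<in> space unit_measure" and T: "(x, \<xi>) \<in> kernel_triangle"
      then have y: "y \<in> {0..1}" by simp
      note \<xi> = tri[OF T]
      let ?E = "exp (c * x) * exp (- c * \<xi>)"
      have "((\<lambda>b. - exp (- c * b) * theta_x b * h y) has_real_derivative
          (c * theta_x \<xi> - theta_x' \<xi>) * exp (- c * \<xi>) * h y) (at \<xi> within {0..1})"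
        using DERIV_cmult_right[OF DERIV_mult[OF DERIV_minus[OF exp_deriv] thetax_deriv[OF \<xi>(2)]], of "h y"]
        by (rule DERIV_cong) (simp add: algebra_simps)
      note exp_times = has_derivative_exp_times[OF this, of c x]
      have "(\<lambda>(a, b). ?k a b y) = (\<lambda>(a, b). exp (c * a) * (- exp (- c * b) * theta_x b * h y))"
        by (simp add: fun_eq_iff c_def h_def)
      with exp_times have D: "((\<lambda>(a, b). ?k a b y) has_derivative
          (\<lambda>(a, b). (- c * ?E * theta_x \<xi> * h y) * a + (?E * (c * theta_x \<xi> - theta_x' \<xi>) * h y) * b))
          (at (x, \<xi>) within kernel_triangle)"
        by (elim ssubst has_derivative_eq_rhs) (simp add: fun_eq_iff)
      have L: "((\<lambda>s. lambda s y) has_real_derivative 0) (at \<xi> within {0..1})"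
        by (rule has_field_derivative_transform_within[OF DERIV_const[of "lambda_y y"] zero_less_one \<xi>(2)])
           (use lambda_sep y in auto)
      \<comment> \<open>In \<open>sig \<xi> \<eta> y\<close> the integration variable sits in
        \<open>sigma_y\<close>, so \<open>sigma_eta y\<close> leaves the integral.\<close>
      have "(LINT \<eta>|unit_measure. sig \<xi> \<eta> y * ?k x \<xi> \<eta>) =
          (LINT \<eta>|unit_measure. (- ?E * theta_x \<xi> * sigma_x \<xi> * sigma_eta y) * (sigma_y \<eta> * theta_y \<eta> / (lambda_y \<eta> + mu0)))"
        by (rule Bochner_Integration.integral_cong)
           (use \<xi> y in \<open>auto simp: sigma_sep c_def\<close>)
      then have S: "(LINT \<eta>|unit_measure. sig \<xi> \<eta> y * ?k x \<xi> \<eta>) = - ?E * theta_x \<xi> * sigma_x \<xi> * sigma_eta y * ?I"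
        by (simp only: integral_mult_right_zero)
      have k: "?k x \<xi> y = - ?E * theta_x \<xi> * h y" and kbar: "?kbar x \<xi> = ?E * f \<xi>"
        by (simp_all add: c_def h_def)
      have "f \<xi> + c - lambda_y y / (lambda_y y + mu0) * (theta_x' \<xi> / theta_x \<xi>) = sigma_x \<xi> * (sigma_eta y / theta_y y) * ?I"
        using f_eq[OF \<xi>(2) y nz] by (simp add: c_def)
      \<comment> \<open>Multiplying by \<open>theta_x \<xi> * theta_y y\<close>, nonzero here,
        clears the quotients and produces the bracket that (K1) leaves.\<close>
      then have "(f \<xi> + c - lambda_y y / (lambda_y y + mu0) * (theta_x' \<xi> / theta_x \<xi>)) * (theta_x \<xi> * theta_y y) =
          (sigma_x \<xi> * (sigma_eta y / theta_y y) * ?I) * (theta_x \<xi> * theta_y y)"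
        by simp
      moreover have "lambda_y y / (lambda_y y + mu0) * (theta_x' \<xi> / theta_x \<xi>) * (theta_x \<xi> * theta_y y) = lambda_y y * theta_x' \<xi> * h y"
        using thetax_nz[OF \<xi>(2)] by (simp add: h_def)
      moreover have "(sigma_x \<xi> * (sigma_eta y / theta_y y) * ?I) * (theta_x \<xi> * theta_y y) = theta_x \<xi> * sigma_x \<xi> * sigma_eta y * ?I"
        using nz by simp
      ultimately have F: "theta_x \<xi> * theta_y y * (f \<xi> + c) - lambda_y y * theta_x' \<xi> * h y = theta_x \<xi> * sigma_x \<xi> * sigma_eta y * ?I"
        by (metis left_diff_distrib mult.commute)
      \<comment> \<open>The \<xi>-derivative of the exponential has the opposite sign to the
        x-derivative, so the two speeds in (K1) add up and cancel the denominator of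
        \<open>h\<close>.\<close>
      have hy: "(lambda_y y + mu0) * h y = theta_y y"
        using denom[OF y] by (simp add: h_def)
      have "mu0 * (- c * ?E * theta_x \<xi> * h y) - lambda_y y * (?E * (c * theta_x \<xi> - theta_x' \<xi>) * h y)
          - theta_x \<xi> * theta_y y * (?E * f \<xi>)
        = - ?E * (c * theta_x \<xi> * ((lambda_y y + mu0) * h y) + theta_x \<xi> * theta_y y * f \<xi> - lambda_y y * theta_x' \<xi> * h y)"
        by (simp add: algebra_simps)
      also have "\<dots> = - ?E * (theta_x \<xi> * theta_y y * (f \<xi> + c) - lambda_y y * theta_x' \<xi> * h y)"
        unfolding hy by (simp add: algebra_simps)
      also have "\<dots> = - ?E * theta_x \<xi> * sigma_x \<xi> * sigma_eta y * ?I"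
        unfolding F by simp
      finally have E: "mu x * (- c * ?E * theta_x \<xi> * h y) - lambda \<xi> y * (?E * (c * theta_x \<xi> - theta_x' \<xi>) * h y)
          - theta \<xi> y * ?kbar x \<xi> = ?k x \<xi> y * 0 + (LINT \<eta>|unit_measure. sig \<xi> \<eta> y * ?k x \<xi> \<eta>)"
        unfolding S kbar using \<xi> y by (simp add: mu_const(2) lambda_sep theta_sep)
      show "kernel_pde_at mu lambda sig theta ?k ?kbar x \<xi> y"
        unfolding kernel_pde_at_def using D L E by blast
    qed
  next
    show "\<forall>(x, \<xi>)\<in>kernel_triangle. kernel_bar_pde_at mu W ?k ?kbar x \<xi>"
    proof clarify
      fix x \<xi> assume T: "(x, \<xi>) \<in> kernel_triangle"
      note \<xi> = tri[OF T]
      let ?E = "exp (c * x) * exp (- c * \<xi>)"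
      let ?J = "LINT y|unit_measure. W_y y * theta_y y / (lambda_y y + mu0)"
      let ?f' = "- (1 / mu0) * (W_x \<xi> * theta_x \<xi> * ?J)"
      have "((\<lambda>b. f b * exp (- c * b)) has_real_derivative (?f' - c * f \<xi>) * exp (- c * \<xi>)) (at \<xi> within {0..1})"
        using DERIV_mult[OF f_deriv[OF \<xi>(2)] exp_deriv]
        by (rule DERIV_cong) (simp add: left_diff_distrib)
      note exp_times = has_derivative_exp_times[OF this, of c x]
      have "(\<lambda>(a, b). ?kbar a b) = (\<lambda>(a, b). exp (c * a) * (f b * exp (- c * b)))"
        by (simp add: fun_eq_iff c_def)
      with exp_times have D: "((\<lambda>(a, b). ?kbar a b) has_derivative
          (\<lambda>(a, b). (c * ?E * f \<xi>) * a + (?E * (?f' - c * f \<xi>)) * b)) (at (x, \<xi>) within kernel_triangle)"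
        by (elim ssubst has_derivative_eq_rhs) (simp add: fun_eq_iff)
      have M: "(mu has_real_derivative 0) (at \<xi> within {0..1})"
        by (rule has_field_derivative_transform_within[OF DERIV_const[of mu0] zero_less_one \<xi>(2)])
           (use mu_const in auto)
      have "(LINT y|unit_measure. W \<xi> y * ?k x \<xi> y) =
          (LINT y|unit_measure. (- ?E * theta_x \<xi> * W_x \<xi>) * (W_y y * theta_y y / (lambda_y y + mu0)))"
        by (rule Bochner_Integration.integral_cong) (use \<xi> in \<open>auto simp: W_sep c_def\<close>)
      then have S: "(LINT y|unit_measure. W \<xi> y * ?k x \<xi> y) = - ?E * theta_x \<xi> * W_x \<xi> * ?J"
        by (simp only: integral_mult_right_zero)
      \<comment> \<open>(K2) differentiates along (1,1), where \<open>exp (c * (x - \<xi>))\<close>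
        is constant, so only the derivative of \<open>f\<close> survives.\<close>
      have "mu0 * (c * ?E * f \<xi>) + mu0 * (?E * (?f' - c * f \<xi>)) = ?E * (mu0 * ?f')"
        by (simp add: algebra_simps)
      also have "mu0 * ?f' = - (W_x \<xi> * theta_x \<xi> * ?J)"
        using mu_const(1) by simp
      finally have E: "mu x * (c * ?E * f \<xi>) + mu \<xi> * (?E * (?f' - c * f \<xi>)) =
          - 0 * ?kbar x \<xi> + (LINT y|unit_measure. W \<xi> y * ?k x \<xi> y)"
        unfolding S using \<xi> by (simp add: mu_const(2) mult_ac)
      show "kernel_bar_pde_at mu W ?k ?kbar x \<xi>"
        unfolding kernel_bar_pde_at_def using D M E by blast
    qed
  next
    show "AE y in unit_measure. \<forall>x\<in>{0..1}. ?k x x y = - theta x y / (lambda x y + mu x)"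
      using AE_space
      by eventually_elim
         (auto simp: theta_sep lambda_sep mu_const(2) exp_minus)
  next
    show "\<forall>x\<in>{0..1}. mu 0 * ?kbar x 0 = (LINT y|unit_measure. q y * lambda 0 y * ?k x 0 y)"
    proof
      fix x :: real assume x: "x \<in> {0..1}"
      let ?Q = "LINT \<eta>|unit_measure. lambda_y \<eta> * q \<eta> * (theta_y \<eta> / (lambda_y \<eta> + mu0))"
      \<comment> \<open>(B2) has no free \<open>y\<close>: evaluated at one common \<open>y\<close>,
        the y-dependent terms of the two conditions cancel.\<close>
      obtain y where y: "y \<in> {0..1}" "theta_y y \<noteq> 0"
        by (rule unit_measure_AE_witness[OF thetay_nz])
      have "mu0 * f 0 = mu0 * sigma_x 0 * (sigma_eta y / theta_y y) * ?I
          + mu0 * lambda_y y / (lambda_y y + mu0) * (theta_x' 0 / theta_x 0) - c_x"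
        using f_eq[of 0 y] y mu_const(1) by (simp add: distrib_left right_diff_distrib)
      also have "\<dots> = - (theta_x 0 * ?Q)"
        using c_x_eq[OF y] by linarith
      finally have f0: "mu0 * f 0 = - (theta_x 0 * ?Q)" .
      have "(LINT y|unit_measure. q y * lambda 0 y * ?k x 0 y) =
          (LINT y|unit_measure. (- exp (c * x) * theta_x 0) * (lambda_y y * q y * (theta_y y / (lambda_y y + mu0))))"
        by (rule Bochner_Integration.integral_cong) (auto simp: lambda_sep c_def)
      also have "\<dots> = exp (c * x) * (- (theta_x 0 * ?Q))"
        unfolding integral_mult_right_zero by simp
      also have "\<dots> = mu 0 * ?kbar x 0"
        unfolding f0[symmetric] using mu_const(2)[of 0] by (simp add: c_def)
      finally show "mu 0 * ?kbar x 0 = (LINT y|unit_measure. q y * lambda 0 y * ?k x 0 y)" ..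
    qed
  qed
  have unique: "(AE y in unit_measure. \<forall>(x, \<xi>)\<in>kernel_triangle. k x \<xi> y = ?k x \<xi> y) \<and>
      (\<forall>(x, \<xi>)\<in>kernel_triangle. kbar x \<xi> = ?kbar x \<xi>)"
    if bdd: "bounded (sigma_x ` {0..1})" "bounded (W_x ` {0..1})"
      and other: "kernel_solution mu lambda W sig theta q k kbar" for k kbar
  proof -
    have image: "bounded (g ` {0..1})" if "continuous_on {0..1} g" for g :: "real \<Rightarrow> real"
      by (rule compact_imp_bounded[OF compact_continuous_image[OF that compact_Icc]])
    have "bounded (sigma_x ` {0..1} \<union> W_x ` {0..1} \<union> theta_x ` {0..1} \<union> lambda_y ` {0..1} \<union> W_y ` {0..1} \<union>
        sigma_y ` {0..1} \<union> sigma_eta ` {0..1} \<union> theta_y ` {0..1} \<union> q ` {0..1})"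
      using bdd cont thetax_cont by (simp add: image)
    then obtain a where a: "\<forall>z\<in>sigma_x ` {0..1} \<union> W_x ` {0..1} \<union> theta_x ` {0..1} \<union> lambda_y ` {0..1} \<union> W_y ` {0..1} \<union>
        sigma_y ` {0..1} \<union> sigma_eta ` {0..1} \<union> theta_y ` {0..1} \<union> q ` {0..1}. norm z \<le> a"
      unfolding bounded_iff by (rule exE)
    define M where "M = max 1 a"
    have M: "\<bar>sigma_x t\<bar> \<le> M" "\<bar>W_x t\<bar> \<le> M" "\<bar>theta_x t\<bar> \<le> M" "\<bar>lambda_y t\<bar> \<le> M" "\<bar>W_y t\<bar> \<le> M"
        "\<bar>sigma_y t\<bar> \<le> M" "\<bar>sigma_eta t\<bar> \<le> M" "\<bar>theta_y t\<bar> \<le> M" "\<bar>q t\<bar> \<le> M" if "t \<in> {0..1}" for t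
      using a that by (simp_all add: M_def ball_Un le_max_iff_disj)
    have "M \<ge> 1" by (simp add: M_def)
    \<comment> \<open>\<open>M\<^sup>2 * M\<close> is for the three factors of \<open>sig\<close>,
      and dominates \<open>M\<^sup>2\<close> for \<open>W\<close> and \<open>theta\<close> since
      \<open>M \<ge> 1\<close>; the term \<open>M\<^sup>2 / mu0\<close> secures
      \<open>M\<^sup>2 \<le> mu0 * C\<close> for \<open>q * lambda\<close>.\<close>
    define C where "C = M\<^sup>2 * M + M\<^sup>2 / mu0"
    have MM: "M\<^sup>2 * 1 \<le> M\<^sup>2 * M"
      using \<open>M \<ge> 1\<close> by (intro mult_left_mono) auto
    have C: "M\<^sup>2 * M \<le> C" "M\<^sup>2 \<le> C" "M\<^sup>2 \<le> mu0 * C"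
      using MM mu_const(1) \<open>M \<ge> 1\<close> by (simp_all add: C_def distrib_left add_increasing2)
    have prod2: "\<bar>u * v\<bar> \<le> M\<^sup>2" if "\<bar>u\<bar> \<le> M" "\<bar>v\<bar> \<le> M" for u v
      unfolding abs_mult power2_eq_square using that by (intro mult_mono) auto
    show ?thesis
    proof (rule kernel_solution_unique[where m = mu0 and l = lambda_y and C = C, OF mu_const lambda_sep lambda_pos _ _ _ _ _ _ _ other sol])
      fix \<xi> y :: real assume \<xi>: "\<xi> \<in> {0..1}" and y: "y \<in> {0..1}"
      have "(\<lambda>\<eta>. sigma_x \<xi> * sigma_y \<eta> * sigma_eta y) \<in> borel_measurable unit_measure"
        by (intro continuous_unit_measurable continuous_intros cont)
      then show "(\<lambda>\<eta>. sig \<xi> \<eta> y) \<in> borel_measurable unit_measure"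
        by (rule measurable_cong[THEN iffD1, rotated]) (use \<xi> y sigma_sep in auto)
      show "\<bar>W \<xi> y\<bar> \<le> C" "\<bar>theta \<xi> y\<bar> \<le> C"
        unfolding W_sep[OF \<xi> y] theta_sep[OF \<xi> y]
        by (rule order_trans[OF prod2 C(2)]; rule M; rule \<xi> y)+
      fix \<eta> :: real assume \<eta>: "\<eta> \<in> {0..1}"
      have "\<bar>sigma_x \<xi> * sigma_y \<eta>\<bar> * \<bar>sigma_eta y\<bar> \<le> M\<^sup>2 * M"
        by (intro mult_mono prod2 M \<xi> y \<eta>) simp_all
      then show "\<bar>sig \<xi> \<eta> y\<bar> \<le> C"
        using C(1) \<xi> \<eta> y by (simp add: sigma_sep abs_mult)
    next
      fix \<xi> :: real assume \<xi>: "\<xi> \<in> {0..1}"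
      have "(\<lambda>y. W_x \<xi> * W_y y) \<in> borel_measurable unit_measure"
        by (intro continuous_unit_measurable continuous_intros cont)
      then show "W \<xi> \<in> borel_measurable unit_measure"
        by (rule measurable_cong[THEN iffD1, rotated]) (use \<xi> W_sep in auto)
    next
      have "(\<lambda>y. q y * lambda_y y) \<in> borel_measurable unit_measure"
        by (intro continuous_unit_measurable continuous_intros cont)
      then show "(\<lambda>y. q y * lambda 0 y) \<in> borel_measurable unit_measure"
        by (rule measurable_cong[THEN iffD1, rotated]) (use lambda_sep in auto)
    next
      fix y :: real assume y: "y \<in> {0..1}"
      show "\<bar>q y * lambda 0 y\<bar> \<le> mu0 * C"
        using prod2[of "q y" "lambda_y y"] M[OF y] C(3) y by (simp add: lambda_sep)
    qed auto
  qed
  show ?thesis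
    using sol unique by blast
qed

end
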